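(* Let $n\in\mathbb{N}$, $n>1$, let $d$ be a pseudometric on $D_n$, let $d^{(n)}$ be the pseudometric on $\mathbb{Z}$ extended from $d$, and let $M$ be a set with $D_n\subseteq M\subseteq\mathbb{Z}$. Then $$\text{(a)}\quad M/\!\sim_{d^{(n)}}\ \simeq\ D_n/\!\sim_d,\qquad\qquad \text{(b)}\quad M/\!\sim_{\preceq_{d^{(n)}}}\ \simeq\ D_n/\!\sim_{\preceq_d}.$$ Equivalently, $\sim_{d^{(n)}}\simeq\sim_d$ and $\sim_{\preceq_{d^{(n)}}}\simeq\sim_{\preceq_d}$.
   Context: $\mathbb{N}$ is the set of positive integers and $D_n=\{x\in\mathbb{N}: x\mid n\}$. A pseudometric on a set $S$ is a function $d:S\times S\to\mathbb{R}$ with $d(x,x)=0$, $d(x,y)=d(y,x)$ and $d(x,z)\le d(x,y)+d(y,z)$. The extension of a pseudometric $d$ on $D_n$ is $d^{(n)}(x,y)=d(\gcd(x,n),\gcd(y,n))$ for $x,y\in\mathbb{Z}$ (and by restriction on $M$). For a pseudometric $d$ on a set $S\subseteq\mathbb{Z}$ with $1\in S$: the induced preorder is $x\preceq_d y\iff d(1,x)\le d(1,y)$; the equivalence relations $\sim_d$ and $\sim_{\preceq_d}$ on $S$ are $x\sim_d y\iff d(x,y)=0$ and $x\sim_{\preceq_d}y\iff (x\preceq_d y\text{ and }y\preceq_d x)$. $S/\!\sim$ denotes the set of equivalence classes. Isomorphism: equivalence relations $\sim_1$ on $M_1$ and $\sim_2$ on $M_2$ (or their quotient sets $M_1/\!\sim_1$,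 $M_2/\!\sim_2$) are called isomorphic, written $\simeq$, if there is a map $\rho:M_1\to M_2$ with $x\sim_1 y\iff\rho(x)\sim_2\rho(y)$ for all $x,y\in M_1$. *)

theory Defs
  imports Complex_Main "HOL-Library.FuncSet"
begin

definition divisor_set :: "nat \<Rightarrow> int set" where
  "divisor_set n = {x. 0 < x \<and> x dvd int n}"

text \<open>A pseudometric on \<open>S\<close> is a total function of which only the values on
  \<open>S \<times> S\<close> are constrained; restriction to a subset is a change of the set argument.
  No sign condition is needed: nonnegativity on \<open>S\<close> follows.\<close>

definition pseudometric_on :: "'a set \<Rightarrow> ('a \<Rightarrow> 'a \<Rightarrow> real) \<Rightarrow> bool" where
  "pseudometric_on S d \<longleftrightarrow>
     (\<forall>x\<in>S. d x x = 0) \<and>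
     (\<forall>x\<in>S. \<forall>y\<in>S. d x y = d y x) \<and>
     (\<forall>x\<in>S. \<forall>y\<in>S. \<forall>z\<in>S. d x z \<le> d x y + d y z)"

definition gcd_extension :: "nat \<Rightarrow> (int \<Rightarrow> int \<Rightarrow> real) \<Rightarrow> int \<Rightarrow> int \<Rightarrow> real" where
  "gcd_extension n d x y = d (gcd x (int n)) (gcd y (int n))"

definition pm_equiv :: "int set \<Rightarrow> (int \<Rightarrow> int \<Rightarrow> real) \<Rightarrow> (int \<times> int) set" where
  "pm_equiv S d = {(x, y). x \<in> S \<and> y \<in> S \<and> d x y = 0}"

definition pm_preorder :: "int set \<Rightarrow> (int \<Rightarrow> int \<Rightarrow> real) \<Rightarrow> (int \<times> int) set" where
  "pm_preorder S d = {(x, y). x \<in> S \<and> y \<in> S \<and> d 1 x \<le> d 1 y}"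

definition preorder_equiv :: "('a \<times> 'a) set \<Rightarrow> ('a \<times> 'a) set" where
  "preorder_equiv r = {(x, y). (x, y) \<in> r \<and> (y, x) \<in> r}"

text \<open>Isomorphism of equivalence relations \<open>R\<close> on \<open>A\<close> and \<open>Q\<close> on \<open>B\<close>, which is by definition
  also the isomorphism \<open>A // R \<simeq> B // Q\<close> of their quotient sets. Surjectivity of the map on
  classes is deliberately not part of the notion.\<close>

definition equivs_isomorphic ::
    "'a set \<Rightarrow> ('a \<times> 'a) set \<Rightarrow> 'b set \<Rightarrow> ('b \<times> 'b) set \<Rightarrow> bool" where
  "equivs_isomorphic A R B Q \<longleftrightarrow>
     equiv A R \<and> equiv B Q \<and>
     (\<exists>\<rho>. \<rho> \<in> A \<rightarrow> B \<and> (\<forall>x\<in>A. \<forall>y\<in>A. (x, y) \<in> R \<longleftrightarrow> (\<rho> x, \<rho> y) \<in> Q))"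

end

theory Submission
  imports Defs
begin

text \<open>The map \<open>x \<mapsto> gcd x n\<close> sends \<open>M\<close> into \<open>D\<^sub>n\<close> and fixes \<open>1\<close>, and both equivalence relations
  on \<open>M\<close> are the pullbacks along it of the corresponding relations on \<open>D\<^sub>n\<close>.\<close>

text \<open>The witness is \<open>\<rho>\<close> itself, since the required biconditional is the
  definition of \<open>R\<close>. What remains is that \<open>R\<close> is an equivalence on
  \<open>A\<close>: reflexivity, symmetry and transitivity are inherited from \<open>Q\<close> along
  any map into \<open>B\<close>.\<close>

lemma equivs_isomorphic_pullback:
  assumes "equiv B Q" and "\<rho> \<in> A \<rightarrow> B"
    and "R = {(x, y). x \<in> A \<and> y \<in> A \<and> (\<rho> x, \<rho> y) \<in> Q}"
  shows "equivs_isomorphic A R B Q"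
proof -
  have refl: "(b, b) \<in> Q" if "b \<in> B" for b
    using assms(1) that by (meson equiv_def refl_onD)
  have sym: "(c, b) \<in> Q" if "(b, c) \<in> Q" for b c
    using assms(1) that by (meson equiv_def symD)
  have trans: "(a, c) \<in> Q" if "(a, b) \<in> Q" "(b, c) \<in> Q" for a b c
    using assms(1) that by (meson equiv_def transD)
  have "equiv A R"
    unfolding assms(3) using assms(2)
    by (auto intro!: equivI refl_onI symI transI intro: refl sym trans)
  then show ?thesis
    unfolding equivs_isomorphic_def using assms by auto
qed

text \<open>Going from \<open>x\<close> to \<open>y\<close> and back, the triangle inequality and
  symmetry give 0 \<le> 2 * \<open>d x y\<close>.\<close>

lemma pseudometric_on_nonneg:
  assumes "pseudometric_on S d" and "x \<in> S" and "y \<in> S"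
  shows "0 \<le> d x y"
proof -
  have "d x x \<le> d x y + d y x" "d x x = 0" "d y x = d x y"
    using assms unfolding pseudometric_on_def by blast+
  then show ?thesis by simp
qed

lemma equiv_pm_equiv:
  assumes "pseudometric_on S d"
  shows "equiv S (pm_equiv S d)"
proof (rule equivI)
  show "pm_equiv S d \<subseteq> S \<times> S" "refl_on S (pm_equiv S d)" "sym (pm_equiv S d)"
    using assms unfolding pm_equiv_def pseudometric_on_def refl_on_def sym_def by auto
  show "trans (pm_equiv S d)"
  proof (rule transI)
    fix x y z
    assume "(x, y) \<in> pm_equiv S d" and "(y, z) \<in> pm_equiv S d"
    then have xyz: "x \<in> S" "y \<in> S" "z \<in> S" and "d x y = 0" "d y z = 0"
      unfolding pm_equiv_def by auto
    moreover have "d x z \<le> d x y + d y z"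
      using assms xyz unfolding pseudometric_on_def by blast
    \<comment> \<open>The triangle inequality bounds \<open>d x z\<close> above by 0; nonnegativity
      bounds it below.\<close>
    ultimately have "d x z = 0"
      using pseudometric_on_nonneg[OF assms, of x z] by linarith
    with xyz show "(x, z) \<in> pm_equiv S d"
      unfolding pm_equiv_def by simp
  qed
qed

text \<open>By antisymmetry of \<le> on the reals, this relation is the kernel of the map
  \<open>x\<close> \<mapsto> \<open>d 1 x\<close> on \<open>S\<close>.\<close>

lemma equiv_preorder_equiv_pm_preorder: "equiv S (preorder_equiv (pm_preorder S d))"
  unfolding preorder_equiv_def pm_preorder_def
  by (auto intro!: equivI refl_onI symI transI)

text \<open>Positivity of \<open>n\<close> excludes \<open>gcd 0 0 = 0\<close>, which is not a
  positive divisor.\<close>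

lemma gcd_in_divisor_set:
  assumes "n > 0"
  shows "gcd x (int n) \<in> divisor_set n"
  using assms unfolding divisor_set_def by simp

theorem proposition2p3:
  fixes n :: nat and d :: "int \<Rightarrow> int \<Rightarrow> real" and M :: "int set"
  assumes "n > 1"
    and "pseudometric_on (divisor_set n) d"
    and "divisor_set n \<subseteq> M"
  shows "equivs_isomorphic
           M (pm_equiv M (gcd_extension n d))
           (divisor_set n) (pm_equiv (divisor_set n) d) \<and>
         equivs_isomorphic
           M (preorder_equiv (pm_preorder M (gcd_extension n d)))
           (divisor_set n) (preorder_equiv (pm_preorder (divisor_set n) d))"
proof -
  have gcd_in: "gcd x (int n) \<in> divisor_set n" for x
    using assms(1) by (intro gcd_in_divisor_set) simp
  then have maps: "(\<lambda>x. gcd x (int n)) \<in> M \<rightarrow> divisor_set n"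
    by simp
  show ?thesis
    \<comment> \<open>The goals left by \<open>intro\<close> say that each relation on
      \<open>M\<close> is a pullback. For the preorder this uses \<open>gcd 1 (int n) = 1\<close>,
      so that distances from 1 under the extension are distances from 1 under
      \<open>d\<close>.\<close>
    by (intro conjI equivs_isomorphic_pullback[OF equiv_pm_equiv[OF assms(2)] maps]
        equivs_isomorphic_pullback[OF equiv_preorder_equiv_pm_preorder maps])
      (auto simp: pm_equiv_def preorder_equiv_def pm_preorder_def gcd_extension_def gcd_in)
qed

end
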